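(* (1) Let $I$ be a set. Then there exist a group $G$ and an embedding of the restricted relation algebra $r(I)$ in the restricted subset algebra $p(G)$. Namely, for any family $(X_i)_{i\in I}$ of pairwise disjoint infinite sets, if we take $G=G_{(X_i)}$, then the map $|r(I)|\to|p(G)|$ defined by $\rho\mapsto S_\rho\subseteq |G|$ is such an embedding. (2) Inversely, given any group $G$, there exist a set $I$ and an embedding of $p(G)$ in $r(I)$. Namely, for $I=|G|$, such an embedding is given by $$S\ \mapsto\ \{(g,gs) : g\in|G|,\ s\in S\},$$ equivalently, $S\mapsto\{(g,h)\in|G|\times|G| : g^{-1}h\in S\}$. (3) Thus, if $A$ is any algebra with four operations, two binary, one unary and one zeroary, then $A$ is embeddable in the restricted relation algebra $r(I)$ of some set $I$ if and only if it is embeddable in the restricted subset algebra $p(G)$ of some group $G$.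
   Context: Algebras are in the sense of universal algebra; $|A|$ denotes the underlying set of an algebra (or group) $A$. An embedding of algebras of the same type is an injective map of underlying sets respecting all the listed operations (matched in the listed order). Permutations are written to the right of their arguments and composed accordingly, so $x(gh)=(xg)h$. Restricted relation algebra: for a set $I$, $r(I)=(|r(I)|,\ \cap,\ \circ,\ {}^{-1},\ 1)$, where $|r(I)|$ is the set of all reflexive binary relations on $I$ (subsets $\rho\subseteq I\times I$ containing $\{(i,i):i\in I\}$), $\cap$ is intersection, $\rho\circ\sigma=\{(i,k)\in I\times I : (\exists j\in I)\ (i,j)\in\rho,\ (j,k)\in\sigma\}$, $\rho^{-1}=\{(i,j)\in I\times I : (j,i)\in\rho\}$, and the constant $1$ is $I\times I$. Restricted subset algebra: for a group $G$ with identity element $e$, $p(G)=(|p(G)|,\ \cap,\ \cdot,\ {}^{-1},\ |G|)$, where $|p(G)|=\{S\subseteq|G| : e\in S\}$, $\cap$ is intersection, $S\cdot T=\{gh : g\in S,\ h\in T\}$, $S^{-1}=\{g^{-1} : g\in S\}$, and the constant $|G|$ is the improper subset of $|G|$. The group $G_{(X_i)}$ and the sets $S_\rho$: let $(X_i)_{i\in I}$ be a family of pairwise disjoint infinite sets with union $X=\bigcup_{i\in I}X_i$, and for $x\in X$ let $\iota(x)\in I$ be the index such that $x\in X_{\iota(x)}$. Then $G_{(X_i)}$ is the group of those permutations $g$ of $X$ such that $\iota(xg)=\iota(x)$ for all but finitely many $x\in X$. For $\rho\in|r(I)|$, $S_\rho=\{g\in|G_{(X_i)}| : (\forall x\in X)\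 (\iota(x),\iota(xg))\in\rho\}$. *)

theory Defs
  imports "HOL-Algebra.Coset" "HOL-Combinatorics.Permutations" "HOL-Library.Disjoint_Sets"
begin

section \<open>Algebras with two binary, one unary and one zeroary operation\<close>

record 'a alg = "'a partial_object" +
  op_meet :: "'a \<Rightarrow> 'a \<Rightarrow> 'a"
  op_comp :: "'a \<Rightarrow> 'a \<Rightarrow> 'a"
  op_conv :: "'a \<Rightarrow> 'a"
  op_top :: 'a

definition is_alg :: "'a alg \<Rightarrow> bool" where
  "is_alg A \<longleftrightarrow>
     (\<forall>x\<in>carrier A. \<forall>y\<in>carrier A. op_meet A x y \<in> carrier A) \<and>
     (\<forall>x\<in>carrier A. \<forall>y\<in>carrier A. op_comp A x y \<in> carrier A) \<and>
     (\<forall>x\<in>carrier A. op_conv A x \<in> carrier A) \<and>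
     op_top A \<in> carrier A"

definition embedding :: "'a alg \<Rightarrow> 'b alg \<Rightarrow> ('a \<Rightarrow> 'b) \<Rightarrow> bool" where
  "embedding A B f \<longleftrightarrow>
     f \<in> carrier A \<rightarrow> carrier B \<and>
     inj_on f (carrier A) \<and>
     (\<forall>x\<in>carrier A. \<forall>y\<in>carrier A. f (op_meet A x y) = op_meet B (f x) (f y)) \<and>
     (\<forall>x\<in>carrier A. \<forall>y\<in>carrier A. f (op_comp A x y) = op_comp B (f x) (f y)) \<and>
     (\<forall>x\<in>carrier A. f (op_conv A x) = op_conv B (f x)) \<and>
     f (op_top A) = op_top B"

definition embeddable :: "'a alg \<Rightarrow> 'b alg \<Rightarrow> bool" where
  "embeddable A B \<longleftrightarrow> (\<exists>f. embedding A B f)"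

section \<open>Restricted relation algebras and restricted subset algebras\<close>

definition rel_alg :: "'i set \<Rightarrow> ('i \<times> 'i) set alg" where
  "rel_alg I =
     \<lparr>carrier = {\<rho>. \<rho> \<subseteq> I \<times> I \<and> refl_on I \<rho>},
      op_meet = (\<inter>), op_comp = (O), op_conv = converse, op_top = I \<times> I\<rparr>"

definition subset_alg :: "('g, 'm) monoid_scheme \<Rightarrow> 'g set alg" where
  "subset_alg G =
     \<lparr>carrier = {S. S \<subseteq> carrier G \<and> \<one>\<^bsub>G\<^esub> \<in> S},
      op_meet = (\<inter>), op_comp = set_mult G, op_conv = SET_INV G, op_top = carrier G\<rparr>"

lemma is_alg_rel_alg: "is_alg (rel_alg I)"
  by (auto simp: is_alg_def rel_alg_def refl_on_def)

lemma is_alg_subset_alg: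
  assumes "group G"
  shows "is_alg (subset_alg G)"
proof -
  interpret group G by fact
  have "\<one>\<^bsub>G\<^esub> \<in> S <#>\<^bsub>G\<^esub> T" if "\<one>\<^bsub>G\<^esub> \<in> S" "\<one>\<^bsub>G\<^esub> \<in> T" for S T
    using that unfolding set_mult_def by (force intro: bexI[of _ "\<one>\<^bsub>G\<^esub>"])
  moreover have "\<one>\<^bsub>G\<^esub> \<in> set_inv\<^bsub>G\<^esub> S" if "\<one>\<^bsub>G\<^esub> \<in> S" for S
    using that unfolding SET_INV_def by (force intro: bexI[of _ "\<one>\<^bsub>G\<^esub>"])
  moreover have "set_inv\<^bsub>G\<^esub> S \<subseteq> carrier G" if "S \<subseteq> carrier G" for S
    using that by (auto simp: SET_INV_def)
  ultimately show ?thesis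
    by (auto simp: is_alg_def subset_alg_def dest: set_mult_closed[THEN subsetD, rotated 2])
qed

section \<open>The group of a family of sets\<close>

definition fam_index :: "'i set \<Rightarrow> ('i \<Rightarrow> 'x set) \<Rightarrow> 'x \<Rightarrow> 'i" where
  "fam_index I X x = (THE i. i \<in> I \<and> x \<in> X i)"

lemma fam_index_eq:
  assumes "disjoint_family_on X I" "i \<in> I" "x \<in> X i"
  shows "fam_index I X x = i"
  using assms unfolding fam_index_def disjoint_family_on_def by (intro the_equality) auto

text \<open>
  Permutations of the union of the family are functions on the whole type that are
  the identity outside the union. They act on the right, so the product of \<open>g\<close> and \<open>h\<close>
  applies \<open>g\<close> first.
\<close>

definition fam_group :: "'i set \<Rightarrow> ('i \<Rightarrow> 'x set) \<Rightarrow> ('x \<Rightarrow> 'x) monoid" where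
  "fam_group I X =
     \<lparr>carrier = {g. g permutes (\<Union>i\<in>I. X i) \<and>
                   finite {x \<in> (\<Union>i\<in>I. X i). fam_index I X (g x) \<noteq> fam_index I X x}},
      monoid.mult = (\<lambda>g h. h \<circ> g), one = id\<rparr>"

definition fam_rel_set :: "'i set \<Rightarrow> ('i \<Rightarrow> 'x set) \<Rightarrow> ('i \<times> 'i) set \<Rightarrow> ('x \<Rightarrow> 'x) set" where
  "fam_rel_set I X \<rho> =
     {g \<in> carrier (fam_group I X).
        \<forall>x \<in> (\<Union>i\<in>I. X i). (fam_index I X x, fam_index I X (g x)) \<in> \<rho>}"

section \<open>Quantifying over all sets and all groups\<close>

text \<open>
  A formula cannot quantify over types, so for an algebra on \<open>'a\<close>, ``some set'' and
  ``some group'' are rendered by sets and groups on the type \<open>('a, 'u) universe\<close>, where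
  \<open>'u\<close> is a free type variable (one for the sets, another for the groups). As \<open>'u\<close> is
  arbitrary, every set and every group, on whatever type, has an isomorphic copy in such a
  universe. The summands \<open>'a\<close> and \<open>nat\<close> make the universe infinite and at least as large
  as the algebra. Whether the algebra embeds in some \<open>rel_alg I\<close> (or in some
  \<open>subset_alg G\<close>) with \<open>I\<close> (or \<open>G\<close>) on the universe then does not depend on \<open>'u\<close>: one can
  restrict to a subset (or subgroup) that is closed under chosen witnesses for composition
  (or products) and contains witnesses for injectivity.
\<close>

type_synonym ('a, 'u) universe = "'a + nat + 'u"

end

theory Submission
  imports Defs "HOL-Algebra.Weak_Morphisms" "HOL-Library.Equipollence"
begin

text \<open>
  For the map \<open>\<rho> \<mapsto> S\<^sub>\<rho>\<close>, only injectivity and compatibility with composition need an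
  idea, and both come from one fact: the group contains a permutation whose effect on the
  indices is any prescribed finite modification of the given indices
  (\<open>fam_group_prescribe_index\<close>). This holds because the set of points that are to receive
  the index \<open>k\<close> and the set \<open>X k\<close> are infinite and differ by finitely many points, hence are
  equinumerous, and bijections between them can be glued together over all \<open>k\<close>. To split a
  permutation \<open>f\<close> belonging to \<open>\<rho> O \<sigma>\<close> into one for \<open>\<rho>\<close> followed by one for \<open>\<sigma>\<close>
  (\<open>fam_rel_set_comp\<close>), choose for each point an intermediate index. It needs to differ from
  the original one only at the finitely many points whose index \<open>f\<close> changes, so some
  permutation in the group realizes the intermediate indices; this is the first factor and
  determines the second.

  In the other direction, the Cayley representation identifies the subsets of a group with
  the left invariant relations on it.

  Composing these two embeddings proves the equivalence up to a change of the underlying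
  type: the first of them leads to a group of permutations, which may be larger than the type
  on which a group is sought. So a Loewenheim-Skolem argument makes it smaller. The
  existential claims hidden in an embedding into a relation or subset algebra concern only
  composition and injectivity, so the embedding survives restriction to any subset (or
  subgroup) that contains chosen witnesses for injectivity and is closed under chosen
  witnesses for composition. Such a subset need not be larger than a given infinite set
  into which the algebra injects (\<open>small_closed_set\<close>), and can then be copied to the
  required type.
\<close>

section \<open>Embeddings\<close>

lemma embedding_compose:
  assumes "is_alg A" "embedding A B f" "embedding B C g"
  shows "embedding A C (g \<circ> f)"
  using assms unfolding embedding_def is_alg_def
  by (auto simp: Pi_iff inj_on_def)

lemma embedding_rel_alg_iff:
  "embedding A (rel_alg I) f \<longleftrightarrow>
     (\<forall>a\<in>carrier A. f a \<subseteq> I \<times> I \<and> Id_on I \<subseteq> f a) \<and>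
     inj_on f (carrier A) \<and>
     (\<forall>a\<in>carrier A. \<forall>b\<in>carrier A. f (op_meet A a b) = f a \<inter> f b) \<and>
     (\<forall>a\<in>carrier A. \<forall>b\<in>carrier A. f (op_comp A a b) = f a O f b) \<and>
     (\<forall>a\<in>carrier A. f (op_conv A a) = (f a)\<inverse>) \<and>
     f (op_top A) = I \<times> I"
  unfolding embedding_def rel_alg_def refl_on_def by (auto simp: Pi_iff Id_on_def)

lemma embedding_subset_alg_iff:
  "embedding A (subset_alg G) f \<longleftrightarrow>
     (\<forall>a\<in>carrier A. f a \<subseteq> carrier G \<and> \<one>\<^bsub>G\<^esub> \<in> f a) \<and>
     inj_on f (carrier A) \<and>
     (\<forall>a\<in>carrier A. \<forall>b\<in>carrier A. f (op_meet A a b) = f a \<inter> f b) \<and>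
     (\<forall>a\<in>carrier A. \<forall>b\<in>carrier A. f (op_comp A a b) = f a <#>\<^bsub>G\<^esub> f b) \<and>
     (\<forall>a\<in>carrier A. f (op_conv A a) = set_inv\<^bsub>G\<^esub> (f a)) \<and>
     f (op_top A) = carrier G"
  unfolding embedding_def subset_alg_def by (auto simp: Pi_iff)

lemma mem_set_mult: "x \<in> S <#>\<^bsub>G\<^esub> T \<longleftrightarrow> (\<exists>g\<in>S. \<exists>h\<in>T. x = g \<otimes>\<^bsub>G\<^esub> h)"
  by (auto simp: set_mult_def)

lemma mem_set_inv: "x \<in> set_inv\<^bsub>G\<^esub> S \<longleftrightarrow> (\<exists>g\<in>S. x = inv\<^bsub>G\<^esub> g)"
  by (auto simp: SET_INV_def)

section \<open>From relations to sets of permutations\<close>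

lemma infinite_eqpoll_of_finite_diffs:
  assumes "infinite A" "finite (A - B)" "finite (B - A)"
  shows "A \<approx> B"
proof -
  have add: "F \<union> C \<approx> C" if "finite F" "infinite C" for F C :: "'a set"
    using that
  proof (induction F)
    case (insert x F)
    have "insert x (F \<union> C) \<approx> F \<union> C"
      by (rule infinite_insert_eqpoll) (use insert in auto)
    then show ?case
      using insert by (auto intro: eqpoll_trans)
  qed auto
  have inf: "infinite (A \<inter> B)"
    using assms(1,2) by (metis Diff_Diff_Int Diff_infinite_finite)
  have "A \<approx> A \<inter> B"
    using add[OF assms(2) inf] by (simp add: Un_Diff_Int)
  moreover have "B \<approx> A \<inter> B"
    using add[OF assms(3) inf] by (simp add: Un_Diff_Int Int_commute[of A B])
  ultimately show ?thesis
    by (meson eqpoll_sym eqpoll_trans)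
qed

locale infinite_family =
  fixes I :: "'i set" and X :: "'i \<Rightarrow> 'x set"
  assumes disj: "disjoint_family_on X I" and inf: "\<And>i. i \<in> I \<Longrightarrow> infinite (X i)"
begin

definition U where "U = (\<Union>i\<in>I. X i)"
abbreviation idx where "idx \<equiv> fam_index I X"
abbreviation P where "P \<equiv> fam_group I X"

lemma U_I: "i \<in> I \<Longrightarrow> x \<in> X i \<Longrightarrow> x \<in> U"
  by (auto simp: U_def)

lemma idx_eq: "i \<in> I \<Longrightarrow> x \<in> X i \<Longrightarrow> idx x = i"
  using fam_index_eq[OF disj] .

lemma idx_mem: "x \<in> U \<Longrightarrow> idx x \<in> I" and mem_idx: "x \<in> U \<Longrightarrow> x \<in> X (idx x)"
  using idx_eq by (auto simp: U_def)

lemma carrier_fam_group: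
  "g \<in> carrier P \<longleftrightarrow> g permutes U \<and> finite {x \<in> U. idx (g x) \<noteq> idx x}"
  by (simp add: fam_group_def U_def)

lemma fam_group_mem: "g \<in> carrier P \<Longrightarrow> g x \<in> U \<longleftrightarrow> x \<in> U"
  by (metis carrier_fam_group permutes_in_image)

lemma mult_fam_group: "g \<otimes>\<^bsub>P\<^esub> h = h \<circ> g" and one_fam_group: "\<one>\<^bsub>P\<^esub> = id"
  by (simp_all add: fam_group_def)

lemma inverse_mem_fam_group:
  assumes g: "g \<in> carrier P"
  shows "inv_into UNIV g \<in> carrier P"
proof -
  have p: "g permutes U"
    using g by (simp add: carrier_fam_group)
  have "{x \<in> U. idx (inv_into UNIV g x) \<noteq> idx x} \<subseteq> g ` {x \<in> U. idx (g x) \<noteq> idx x}"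
  proof
    fix x assume x: "x \<in> {x \<in> U. idx (inv_into UNIV g x) \<noteq> idx x}"
    let ?y = "inv_into UNIV g x"
    have "g ?y = x" "?y \<in> U"
      using x permutes_inverses(1)[OF p] permutes_in_image[OF permutes_inv[OF p]]
      by auto
    then show "x \<in> g ` {x \<in> U. idx (g x) \<noteq> idx x}"
      using x by (intro image_eqI[of _ _ ?y]) auto
  qed
  then show ?thesis
    using g permutes_inv[OF p] by (auto simp: carrier_fam_group intro: finite_subset)
qed

lemma group_fam_group: "group P"
proof (rule groupI)
  fix g h assume g: "g \<in> carrier P" and h: "h \<in> carrier P"
  have "{x \<in> U. idx (h (g x)) \<noteq> idx x} \<subseteq>
      {x \<in> U. idx (g x) \<noteq> idx x} \<union> g -` {y \<in> U. idx (h y) \<noteq> idx y}"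
    using fam_group_mem[OF g] by auto
  moreover have "finite (g -` {y \<in> U. idx (h y) \<noteq> idx y})"
    using g h by (intro finite_vimageI) (auto simp: carrier_fam_group permutes_inj)
  ultimately show "g \<otimes>\<^bsub>P\<^esub> h \<in> carrier P"
    using g h by (auto simp: carrier_fam_group mult_fam_group permutes_compose
        intro: finite_subset)
next
  fix g assume g: "g \<in> carrier P"
  then show "\<exists>h\<in>carrier P. h \<otimes>\<^bsub>P\<^esub> g = \<one>\<^bsub>P\<^esub>"
    using inverse_mem_fam_group[OF g]
    by (intro bexI[of _ "inv_into UNIV g"])
       (auto simp: carrier_fam_group mult_fam_group one_fam_group permutes_inv_o)
qed (auto simp: carrier_fam_group mult_fam_group one_fam_group permutes_id o_assoc)

sublocale P: group P
  by (rule group_fam_group)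

lemma inv_fam_group: "g \<in> carrier P \<Longrightarrow> inv\<^bsub>P\<^esub> g = inv_into UNIV g"
  by (rule P.inv_equality)
     (use inverse_mem_fam_group in \<open>auto simp: mult_fam_group one_fam_group carrier_fam_group permutes_inv_o\<close>)

text \<open>
  The points that are to receive index \<open>k\<close> differ from \<open>X k\<close> by finitely many points, so
  they can be matched with \<open>X k\<close>. It is here that the sets \<open>X k\<close> have to be infinite.
\<close>

lemma fam_group_prescribe_index:
  assumes j: "\<And>x. x \<in> U \<Longrightarrow> j x \<in> I" and fin: "finite {x \<in> U. j x \<noteq> idx x}"
  obtains g where "g \<in> carrier P" "\<And>x. x \<in> U \<Longrightarrow> idx (g x) = j x"
proof -
  let ?Y = "\<lambda>k. {x \<in> U. j x = k}"
  have "\<exists>h. bij_betw h (?Y k) (X k)" if k: "k \<in> I" for k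
  proof -
    have "X k - ?Y k \<subseteq> {x \<in> U. j x \<noteq> idx x}"
      using idx_eq[OF k] U_I[OF k] by auto
    moreover have "?Y k - X k \<subseteq> {x \<in> U. j x \<noteq> idx x}"
      by (auto dest: mem_idx)
    ultimately have "finite (X k - ?Y k)" "finite (?Y k - X k)"
      using fin by (auto intro: finite_subset)
    then have "X k \<approx> ?Y k"
      using inf[OF k] by (intro infinite_eqpoll_of_finite_diffs)
    then show ?thesis
      using eqpoll_sym unfolding eqpoll_def by blast
  qed
  then obtain h where h: "\<And>k. k \<in> I \<Longrightarrow> bij_betw (h k) (?Y k) (X k)"
    by metis
  define g where "g x = (if x \<in> U then h (j x) x else x)" for x
  have gX: "g x \<in> X (j x)" if "x \<in> U" for x
    using h[OF j[OF that]] that by (auto simp: g_def bij_betw_def)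
  have idx_g: "idx (g x) = j x" if "x \<in> U" for x
    using idx_eq[OF j[OF that] gX[OF that]] .
  have "inj_on g U"
  proof (rule inj_onI)
    fix x y assume x: "x \<in> U" and y: "y \<in> U" and eq: "g x = g y"
    have jxy: "j x = j y"
      using idx_g[OF x] idx_g[OF y] eq by simp
    then have "h (j x) x = h (j x) y"
      using eq x y by (simp add: g_def)
    then show "x = y"
      using h[OF j[OF x]] x y jxy by (auto simp: bij_betw_def inj_on_def)
  qed
  moreover have "g ` U \<subseteq> U"
    using gX j U_I by blast
  moreover have "y \<in> g ` U" if y: "y \<in> U" for y
  proof -
    have "y \<in> h (idx y) ` ?Y (idx y)"
      using h[OF idx_mem[OF y]] mem_idx[OF y] by (simp add: bij_betw_def)
    then obtain x where x: "x \<in> U" "j x = idx y" "y = h (idx y) x"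
      by blast
    then have "g x = y"
      by (simp add: g_def)
    then show ?thesis
      using x(1) by blast
  qed
  ultimately have "bij_betw g U U"
    unfolding bij_betw_def by blast
  then have "g permutes U"
    by (rule bij_imp_permutes) (auto simp: g_def)
  moreover have "{x \<in> U. idx (g x) \<noteq> idx x} = {x \<in> U. j x \<noteq> idx x}"
    using idx_g by auto
  ultimately have "g \<in> carrier P"
    using fin by (simp add: carrier_fam_group)
  then show ?thesis
    using idx_g that by blast
qed

lemma mem_fam_rel_set:
  "g \<in> fam_rel_set I X \<rho> \<longleftrightarrow> g \<in> carrier P \<and> (\<forall>x\<in>U. (idx x, idx (g x)) \<in> \<rho>)"
  by (auto simp: fam_rel_set_def U_def)

text \<open>Membership of a pair in \<open>\<rho>\<close> is detected by a permutation that changes a single index.\<close>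

lemma fam_rel_set_subset_imp:
  assumes \<rho>: "\<rho> \<subseteq> I \<times> I" and \<rho>_refl: "Id_on I \<subseteq> \<rho>"
    and sub: "fam_rel_set I X \<rho> \<subseteq> fam_rel_set I X \<sigma>"
  shows "\<rho> \<subseteq> \<sigma>"
proof
  fix p assume p: "p \<in> \<rho>"
  obtain i k where ik: "p = (i, k)" "i \<in> I" "k \<in> I"
    using p \<rho> by auto
  obtain x where x: "x \<in> X i"
    using inf[OF ik(2)] by fastforce
  \<comment> \<open>A permutation that moves the index of the single point \<open>x\<close>, from \<open>i\<close> to \<open>k\<close>.\<close>
  let ?j = "idx(x := k)"
  have "finite {y \<in> U. ?j y \<noteq> idx y}"
    by (rule finite_subset[of _ "{x}"]) auto
  moreover have "?j y \<in> I" if "y \<in> U" for y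
    using ik idx_mem[OF that] by simp
  ultimately obtain g where g: "g \<in> carrier P" "\<And>y. y \<in> U \<Longrightarrow> idx (g y) = ?j y"
    using fam_group_prescribe_index by blast
  have "(idx y, idx (g y)) \<in> \<rho>" if "y \<in> U" for y
    using g(2)[OF that] p ik \<rho>_refl idx_mem[OF that] idx_eq[OF ik(2) x] by auto
  then have "g \<in> fam_rel_set I X \<sigma>"
    using g(1) sub by (auto simp: mem_fam_rel_set subset_iff)
  then have "(idx x, idx (g x)) \<in> \<sigma>"
    using U_I[OF ik(2) x] by (simp add: mem_fam_rel_set)
  then show "p \<in> \<sigma>"
    using g(2)[OF U_I[OF ik(2) x]] ik(1) idx_eq[OF ik(2) x] by simp
qed

text \<open>
  Where \<open>f\<close> preserves the index, reflexivity allows that index to be the intermediate one as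
  well; this leaves finitely many points with a new index.
\<close>

lemma fam_rel_set_comp:
  assumes \<rho>: "\<rho> \<subseteq> I \<times> I" "Id_on I \<subseteq> \<rho>" and \<sigma>: "Id_on I \<subseteq> \<sigma>"
  shows "fam_rel_set I X (\<rho> O \<sigma>) = fam_rel_set I X \<rho> <#>\<^bsub>P\<^esub> fam_rel_set I X \<sigma>"
proof (intro equalityI subsetI)
  fix f assume f: "f \<in> fam_rel_set I X (\<rho> O \<sigma>)"
  then have fP: "f \<in> carrier P"
    by (simp add: mem_fam_rel_set)
  have "\<exists>k. (idx x, k) \<in> \<rho> \<and> (k, idx (f x)) \<in> \<sigma> \<and> (idx (f x) = idx x \<longrightarrow> k = idx x)"
    if x: "x \<in> U" for x
  proof (cases "idx (f x) = idx x")
    case True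
    then show ?thesis
      using \<rho>(2) \<sigma> idx_mem[OF x] by auto
  next
    case False
    then show ?thesis
      using f x by (auto simp: mem_fam_rel_set)
  qed
  then obtain j where j: "\<And>x. x \<in> U \<Longrightarrow> (idx x, j x) \<in> \<rho>"
      "\<And>x. x \<in> U \<Longrightarrow> (j x, idx (f x)) \<in> \<sigma>"
      "\<And>x. x \<in> U \<Longrightarrow> idx (f x) = idx x \<Longrightarrow> j x = idx x"
    by metis
  have "finite {x \<in> U. j x \<noteq> idx x}"
    by (rule finite_subset[of _ "{x \<in> U. idx (f x) \<noteq> idx x}"])
       (use j(3) fP in \<open>auto simp: carrier_fam_group\<close>)
  moreover have "j x \<in> I" if "x \<in> U" for x
    using j(1)[OF that] \<rho>(1) by auto
  ultimately obtain g where g: "g \<in> carrier P" and idx_g: "\<And>x. x \<in> U \<Longrightarrow> idx (g x) = j x"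
    using fam_group_prescribe_index by blast
  define h where "h = inv\<^bsub>P\<^esub> g \<otimes>\<^bsub>P\<^esub> f"
  have h: "h \<in> carrier P" and f_eq: "f = g \<otimes>\<^bsub>P\<^esub> h"
    using g fP by (simp_all add: h_def flip: P.m_assoc)
  have "(idx y, idx (h y)) \<in> \<sigma>" if y: "y \<in> U" for y
  proof -
    have "y \<in> g ` U"
      using g y by (simp add: carrier_fam_group permutes_image)
    then obtain x where x: "x \<in> U" "y = g x"
      by blast
    then have "h y = f x"
      by (simp add: f_eq mult_fam_group)
    then show ?thesis
      using x idx_g j(2) by simp
  qed
  then have "g \<in> fam_rel_set I X \<rho>" "h \<in> fam_rel_set I X \<sigma>"
    using g h idx_g j(1) by (auto simp: mem_fam_rel_set)
  then show "f \<in> fam_rel_set I X \<rho> <#>\<^bsub>P\<^esub> fam_rel_set I X \<sigma>"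
    using f_eq by (auto simp: mem_set_mult)
next
  fix f assume "f \<in> fam_rel_set I X \<rho> <#>\<^bsub>P\<^esub> fam_rel_set I X \<sigma>"
  then obtain g h where g: "g \<in> fam_rel_set I X \<rho>" and h: "h \<in> fam_rel_set I X \<sigma>"
    and f: "f = g \<otimes>\<^bsub>P\<^esub> h"
    by (auto simp: mem_set_mult)
  have "(idx x, idx (f x)) \<in> \<rho> O \<sigma>" if x: "x \<in> U" for x
  proof -
    have "g x \<in> U"
      using g x fam_group_mem unfolding mem_fam_rel_set by blast
    then have "(idx x, idx (g x)) \<in> \<rho>" "(idx (g x), idx (h (g x))) \<in> \<sigma>"
      using g h x unfolding mem_fam_rel_set by blast+
    then show ?thesis
      by (auto simp: f mult_fam_group)
  qed
  then show "f \<in> fam_rel_set I X (\<rho> O \<sigma>)"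
    using g h f by (auto simp: mem_fam_rel_set)
qed

lemma fam_rel_set_converse:
  "fam_rel_set I X (\<rho>\<inverse>) = set_inv\<^bsub>P\<^esub> (fam_rel_set I X \<rho>)"
proof -
  have inv: "inv\<^bsub>P\<^esub> g \<in> fam_rel_set I X (\<rho>\<inverse>)" if g: "g \<in> fam_rel_set I X \<rho>" for g \<rho>
  proof -
    have gP: "g \<in> carrier P"
      using g by (simp add: mem_fam_rel_set)
    have "(idx ((inv\<^bsub>P\<^esub> g) y), idx y) \<in> \<rho>" if y: "y \<in> U" for y
    proof -
      have "(inv\<^bsub>P\<^esub> g) y \<in> U" "g ((inv\<^bsub>P\<^esub> g) y) = y"
        using y gP fam_group_mem[OF P.inv_closed[OF gP]] permutes_inverses(1)[of g U]
        by (auto simp: inv_fam_group carrier_fam_group)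
      then show ?thesis
        using g unfolding mem_fam_rel_set by metis
    qed
    then show ?thesis
      using gP by (auto simp: mem_fam_rel_set)
  qed
  show ?thesis
  proof (intro equalityI subsetI)
    fix g assume g: "g \<in> fam_rel_set I X (\<rho>\<inverse>)"
    then have "inv\<^bsub>P\<^esub> g \<in> fam_rel_set I X \<rho>" "g = inv\<^bsub>P\<^esub> (inv\<^bsub>P\<^esub> g)"
      using inv[OF g] by (auto simp: mem_fam_rel_set)
    then show "g \<in> set_inv\<^bsub>P\<^esub> (fam_rel_set I X \<rho>)"
      by (auto simp: mem_set_inv)
  qed (use inv in \<open>auto simp: mem_set_inv\<close>)
qed

lemma embedding_fam_rel_set: "embedding (rel_alg I) (subset_alg P) (fam_rel_set I X)"
proof -
  have car: "\<rho> \<in> carrier (rel_alg I) \<longleftrightarrow> \<rho> \<subseteq> I \<times> I \<and> Id_on I \<subseteq> \<rho>" for \<rho>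
    by (auto simp: rel_alg_def refl_on_def)
  have "inj_on (fam_rel_set I X) (carrier (rel_alg I))"
  proof (rule inj_onI)
    fix \<rho> \<sigma> assume "\<rho> \<in> carrier (rel_alg I)" "\<sigma> \<in> carrier (rel_alg I)"
      and "fam_rel_set I X \<rho> = fam_rel_set I X \<sigma>"
    then show "\<rho> = \<sigma>"
      using fam_rel_set_subset_imp[of \<rho> \<sigma>] fam_rel_set_subset_imp[of \<sigma> \<rho>] unfolding car by blast
  qed
  moreover have "fam_rel_set I X (I \<times> I) = carrier P"
    using idx_mem fam_group_mem by (auto simp: mem_fam_rel_set)
  moreover have "\<one>\<^bsub>P\<^esub> \<in> fam_rel_set I X \<rho>" if "\<rho> \<in> carrier (rel_alg I)" for \<rho>
    using that idx_mem P.one_closed unfolding car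
    by (auto simp del: P.one_closed simp: mem_fam_rel_set one_fam_group)
  moreover have "fam_rel_set I X (op_comp (rel_alg I) \<rho> \<sigma>) =
      fam_rel_set I X \<rho> <#>\<^bsub>P\<^esub> fam_rel_set I X \<sigma>"
    if "\<rho> \<in> carrier (rel_alg I)" "\<sigma> \<in> carrier (rel_alg I)" for \<rho> \<sigma>
    using that unfolding car by (simp add: rel_alg_def fam_rel_set_comp)
  ultimately show ?thesis
    unfolding embedding_subset_alg_iff
    by (auto simp: rel_alg_def fam_rel_set_converse mem_fam_rel_set)
qed

end

lemma infinite_family_copies_of_nat: "infinite_family I (\<lambda>i. {i} \<times> (UNIV :: nat set))"
  by unfold_locales (auto simp: disjoint_family_on_def finite_cartesian_product_iff)

section \<open>From subsets of a group to left invariant relations\<close>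

context group
begin

lemma left_translates_eq:
  assumes "S \<subseteq> carrier G"
  shows "{(g, g \<otimes> s) | g s. g \<in> carrier G \<and> s \<in> S} =
    {(g, h) \<in> carrier G \<times> carrier G. inv g \<otimes> h \<in> S}" (is "?L = ?R")
proof (intro equalityI subsetI)
  fix p assume "p \<in> ?L"
  then show "p \<in> ?R"
    using assms by (auto simp: subset_iff simp flip: m_assoc)
next
  fix p assume p: "p \<in> ?R"
  then have "snd p = fst p \<otimes> (inv (fst p) \<otimes> snd p)"
    by (auto simp flip: m_assoc)
  then show "p \<in> ?L"
    using p by (cases p) auto
qed

lemma embedding_left_translates:
  "embedding (subset_alg G) (rel_alg (carrier G))
     (\<lambda>S. {(g, g \<otimes> s) | g s. g \<in> carrier G \<and> s \<in> S})" (is "embedding _ _ ?F")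
proof -
  have F: "(x, y) \<in> ?F S \<longleftrightarrow> x \<in> carrier G \<and> y \<in> carrier G \<and> inv x \<otimes> y \<in> S"
    if "S \<subseteq> carrier G" for S x y
    unfolding left_translates_eq[OF that] by simp
  have inv_closed': "set_inv S \<subseteq> carrier G" if "S \<subseteq> carrier G" for S
    using that by (auto simp: mem_set_inv subset_iff)
  have "inj_on ?F (carrier (subset_alg G))"
  proof (rule inj_onI)
    fix S T assume ST: "S \<in> carrier (subset_alg G)" "T \<in> carrier (subset_alg G)"
      and eq: "?F S = ?F T"
    have sub: "S \<subseteq> carrier G" "T \<subseteq> carrier G"
      using ST by (simp_all add: subset_alg_def)
    have "s \<in> S \<longleftrightarrow> s \<in> T" if s: "s \<in> carrier G" for s
      using F[OF sub(1), of \<one> s] F[OF sub(2), of \<one> s] eq s by simp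
    then show "S = T"
      using sub by blast
  qed
  moreover have "?F (S <#> T) = ?F S O ?F T" if ST: "S \<subseteq> carrier G" "T \<subseteq> carrier G" for S T
  proof (intro equalityI subsetI)
    fix p assume "p \<in> ?F (S <#> T)"
    then obtain g s t where p: "p = (g, g \<otimes> (s \<otimes> t))" and g: "g \<in> carrier G"
      and st: "s \<in> S" "t \<in> T"
      by (auto simp: mem_set_mult)
    have stG: "s \<in> carrier G" "t \<in> carrier G"
      using st ST by auto
    have "(g, g \<otimes> s) \<in> ?F S" "(g \<otimes> s, (g \<otimes> s) \<otimes> t) \<in> ?F T"
      using g st stG by auto
    then have "(g, (g \<otimes> s) \<otimes> t) \<in> ?F S O ?F T"
      by (rule relcompI)
    then show "p \<in> ?F S O ?F T"
      unfolding p using g stG by (simp only: m_assoc)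
  next
    fix p assume "p \<in> ?F S O ?F T"
    then obtain g s t where p: "p = (g, (g \<otimes> s) \<otimes> t)" and g: "g \<in> carrier G"
      and st: "s \<in> S" "t \<in> T"
      by blast
    then have "p = (g, g \<otimes> (s \<otimes> t))" "s \<otimes> t \<in> S <#> T"
      using ST by (auto simp: mem_set_mult m_assoc subset_iff)
    then show "p \<in> ?F (S <#> T)"
      using g by blast
  qed
  moreover have "?F (set_inv S) = (?F S)\<inverse>" if S: "S \<subseteq> carrier G" for S
  proof -
    have "inv x \<otimes> y \<in> set_inv S \<longleftrightarrow> inv y \<otimes> x \<in> S"
      if xy: "x \<in> carrier G" "y \<in> carrier G" for x y
    proof -
      have "inv (inv x \<otimes> y) = inv y \<otimes> x" "inv (inv y \<otimes> x) = inv x \<otimes> y"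
        using xy by (simp_all add: inv_mult_group)
      then show ?thesis
        unfolding mem_set_inv using S xy by (metis inv_inv subsetD)
    qed
    then show ?thesis
      unfolding left_translates_eq[OF S] left_translates_eq[OF inv_closed'[OF S]] by blast
  qed
  moreover have "?F (carrier G) = carrier G \<times> carrier G"
    unfolding left_translates_eq[OF subset_refl] by auto
  moreover have "?F S \<subseteq> carrier G \<times> carrier G \<and> Id_on (carrier G) \<subseteq> ?F S"
    if "S \<subseteq> carrier G" "\<one> \<in> S" for S
    unfolding left_translates_eq[OF that(1)] using that(2) by auto
  moreover have "?F (S \<inter> T) = ?F S \<inter> ?F T" if "S \<subseteq> carrier G" "T \<subseteq> carrier G" for S T
    unfolding left_translates_eq[OF that(1)] left_translates_eq[OF that(2)]
      left_translates_eq[OF le_infI1[OF that(1)]] by blast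
  ultimately show ?thesis
    unfolding embedding_rel_alg_iff by (simp add: subset_alg_def)
qed

end

section \<open>Transport along injections\<close>

lemma embedding_rel_alg_image:
  assumes u: "inj_on u I"
  shows "embedding (rel_alg I) (rel_alg (u ` I)) ((`) (map_prod u u))"
proof -
  have inj: "inj_on (map_prod u u) (I \<times> I)"
    using u by (auto simp: inj_on_def)
  have "inj_on ((`) (map_prod u u)) (carrier (rel_alg I))"
    by (rule inj_onI) (auto simp: rel_alg_def inj_on_image_eq_iff[OF inj])
  moreover have "map_prod u u ` (\<rho> O \<sigma>) = map_prod u u ` \<rho> O map_prod u u ` \<sigma>"
    if \<rho>: "\<rho> \<subseteq> I \<times> I" and \<sigma>: "\<sigma> \<subseteq> I \<times> I" for \<rho> \<sigma>
  proof (intro equalityI subsetI)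
    fix p assume "p \<in> map_prod u u ` \<rho> O map_prod u u ` \<sigma>"
    then obtain x y y' z where *: "(x, y) \<in> \<rho>" "(y', z) \<in> \<sigma>" "u y = u y'" "p = (u x, u z)"
      by auto
    moreover have "y = y'"
      using * \<rho> \<sigma> u by (auto dest: inj_onD)
    ultimately show "p \<in> map_prod u u ` (\<rho> O \<sigma>)"
      by force
  qed force
  moreover have "map_prod u u ` (\<rho> \<inter> \<sigma>) = map_prod u u ` \<rho> \<inter> map_prod u u ` \<sigma>"
    if "\<rho> \<subseteq> I \<times> I" "\<sigma> \<subseteq> I \<times> I" for \<rho> \<sigma>
    using that by (rule inj_on_image_Int[OF inj])
  moreover have "map_prod u u ` (\<rho>\<inverse>) = (map_prod u u ` \<rho>)\<inverse>" for \<rho>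
    by force
  moreover have "map_prod u u ` (I \<times> I) = u ` I \<times> u ` I"
    by (simp add: map_prod_surj_on)
  moreover have "map_prod u u ` \<rho> \<subseteq> u ` I \<times> u ` I \<and> Id_on (u ` I) \<subseteq> map_prod u u ` \<rho>"
    if "\<rho> \<in> carrier (rel_alg I)" for \<rho>
    using that by (force simp: rel_alg_def refl_on_def)
  ultimately show ?thesis
    unfolding embedding_rel_alg_iff by (simp add: rel_alg_def)
qed

lemma embedding_subset_alg_iso:
  assumes G: "group G" and H: "group H" and u: "u \<in> iso G H"
  shows "embedding (subset_alg G) (subset_alg H) ((`) u)"
proof -
  interpret group_hom G H u
    using G H u by (simp add: group_hom_def group_hom_axioms_def iso_def)
  have inj: "inj_on u (carrier G)" and surj: "u ` carrier G = carrier H"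
    using u by (auto simp: iso_def bij_betw_def)
  have "inj_on ((`) u) (carrier (subset_alg G))"
    by (rule inj_onI) (auto simp: subset_alg_def inj_on_image_eq_iff[OF inj])
  moreover have "u ` (S <#>\<^bsub>G\<^esub> T) = u ` S <#>\<^bsub>H\<^esub> u ` T"
    if "S \<subseteq> carrier G" "T \<subseteq> carrier G" for S T
  proof -
    have "u (s \<otimes>\<^bsub>G\<^esub> t) = u s \<otimes>\<^bsub>H\<^esub> u t" if "s \<in> S" "t \<in> T" for s t
      using that \<open>S \<subseteq> carrier G\<close> \<open>T \<subseteq> carrier G\<close> by (simp add: subset_iff)
    then show ?thesis
      by (simp add: set_mult_def image_UN cong: SUP_cong)
  qed
  moreover have "u ` (set_inv\<^bsub>G\<^esub> S) = set_inv\<^bsub>H\<^esub> (u ` S)" if "S \<subseteq> carrier G" for S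
  proof -
    have "u (inv\<^bsub>G\<^esub> s) = inv\<^bsub>H\<^esub> (u s)" if "s \<in> S" for s
      using that \<open>S \<subseteq> carrier G\<close> by (simp add: subset_iff)
    then show ?thesis
      by (simp add: SET_INV_def image_UN cong: SUP_cong)
  qed
  moreover have "u ` (S \<inter> T) = u ` S \<inter> u ` T" if "S \<subseteq> carrier G" "T \<subseteq> carrier G" for S T
    using that by (rule inj_on_image_Int[OF inj])
  moreover have "\<one>\<^bsub>H\<^esub> \<in> u ` S" if "\<one>\<^bsub>G\<^esub> \<in> S" for S
    using that hom_one by (metis imageI)
  moreover have "u ` S \<subseteq> carrier H" if "S \<subseteq> carrier G" for S
    using that by auto
  ultimately show ?thesis
    unfolding embedding_subset_alg_iff using surj by (simp add: subset_alg_def)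
qed

section \<open>Shrinking the set or group under an embedding\<close>

lemma lepoll_iff_ordLeq: "A \<lesssim> B \<longleftrightarrow> ordLeq3 (card_of A) (card_of B)"
  unfolding lepoll_def by (rule card_of_ordLeq)

lemma UN_lepoll_infinite:
  assumes "infinite K" "J \<lesssim> K" "\<And>i. i \<in> J \<Longrightarrow> F i \<lesssim> K"
  shows "(\<Union>i\<in>J. F i) \<lesssim> K"
  using assms unfolding lepoll_iff_ordLeq by (simp add: card_of_UNION_ordLeq_infinite)

lemma Times_lepoll_infinite:
  assumes "infinite K" "A \<lesssim> K" "B \<lesssim> K"
  shows "A \<times> B \<lesssim> K"
  using assms unfolding lepoll_iff_ordLeq by (simp add: card_of_Sigma_ordLeq_infinite)

lemma Un_lepoll_infinite:
  assumes "infinite K" "A \<lesssim> K" "B \<lesssim> K"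
  shows "A \<union> B \<lesssim> K"
proof -
  have "(\<Union>b\<in>UNIV. if b then A else B) \<lesssim> K"
  proof (rule UN_lepoll_infinite[OF assms(1)])
    show "(UNIV :: bool set) \<lesssim> K"
      by (rule finite_lepoll_infinite[OF assms(1)]) simp
  qed (use assms(2,3) in simp)
  then show ?thesis
    by (simp add: UNIV_bool Un_commute)
qed

text \<open>
  One step of closing a set \<open>H\<close> adds at most \<open>|B| |H|\<^sup>2\<close> elements. As \<open>K\<close> is infinite,
  no stage grows larger than \<open>K\<close>, and neither does the union of countably many stages.
\<close>

lemma small_closed_set:
  fixes f :: "'b \<Rightarrow> 'x \<Rightarrow> 'x \<Rightarrow> 'x"
  assumes K: "infinite K" and B: "B \<lesssim> K" and C: "C \<lesssim> K" and "C \<subseteq> D"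
    and D: "\<And>b x y. b \<in> B \<Longrightarrow> x \<in> D \<Longrightarrow> y \<in> D \<Longrightarrow> f b x y \<in> D"
  obtains H where "C \<subseteq> H" "H \<subseteq> D" "H \<lesssim> K"
    "\<And>b x y. b \<in> B \<Longrightarrow> x \<in> H \<Longrightarrow> y \<in> H \<Longrightarrow> f b x y \<in> H"
proof -
  define step where "step H = H \<union> (\<lambda>(b, x, y). f b x y) ` (B \<times> H \<times> H)" for H
  define H where "H n = (step ^^ n) C" for n
  have H0: "H 0 = C" and HS: "H (Suc n) = step (H n)" for n
    by (simp_all add: H_def)
  have small: "H n \<lesssim> K" for n
  proof (induction n)
    case (Suc n)
    have "(\<lambda>(b, x, y). f b x y) ` (B \<times> H n \<times> H n) \<lesssim> K"
      by (rule lepoll_trans[OF image_lepoll]) (intro Times_lepoll_infinite K B Suc)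
    then show ?case
      unfolding HS step_def by (intro Un_lepoll_infinite K Suc)
  qed (simp add: H0 C)
  have sub: "H n \<subseteq> D" for n
  proof (induction n)
    case (Suc n)
    then show ?case
      unfolding HS step_def by (auto intro!: D)
  qed (simp add: H0 \<open>C \<subseteq> D\<close>)
  have "H m \<subseteq> H n" if "m \<le> n" for m n
    by (rule lift_Suc_mono_le[OF _ that]) (auto simp: HS step_def)
  then have max: "H m \<subseteq> H (max m n)" "H n \<subseteq> H (max m n)" for m n
    by simp_all
  have "f b x y \<in> (\<Union>n. H n)" if b: "b \<in> B" and xy: "x \<in> (\<Union>n. H n)" "y \<in> (\<Union>n. H n)" for b x y
  proof -
    obtain m n where "x \<in> H m" "y \<in> H n"
      using xy by blast
    then have "x \<in> H (max m n)" "y \<in> H (max m n)"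
      using max by blast+
    then have "f b x y \<in> H (Suc (max m n))"
      using b by (force simp: HS step_def)
    then show ?thesis
      by blast
  qed
  moreover have "(\<Union>n. H n) \<lesssim> K"
    using K small infinite_le_lepoll[of K] by (intro UN_lepoll_infinite) auto
  moreover have "C \<subseteq> (\<Union>n. H n)"
    using H0 by blast
  moreover have "(\<Union>n. H n) \<subseteq> D"
    using sub by blast
  ultimately show ?thesis
    by (intro that[of "\<Union>n. H n"])
qed

text \<open>
  One element of the symmetric difference of \<open>\<phi> a\<close> and \<open>\<phi> b\<close>, for each pair \<open>a \<noteq> b\<close>, is enough
  to tell all values of \<open>\<phi>\<close> apart.
\<close>

lemma small_separating_set:
  fixes \<phi> :: "'a \<Rightarrow> 'x set"
  assumes "infinite K" "A \<lesssim> K" "inj_on \<phi> A"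
  obtains C where "C \<lesssim> K" "C \<subseteq> (\<Union>a\<in>A. \<phi> a)" "inj_on (\<lambda>a. \<phi> a \<inter> C) A"
proof -
  let ?D = "{(a, b) \<in> A \<times> A. a \<noteq> b}"
  define s where "s = (\<lambda>(a, b). SOME x. x \<in> (\<phi> a - \<phi> b) \<union> (\<phi> b - \<phi> a))"
  have s: "s (a, b) \<in> (\<phi> a - \<phi> b) \<union> (\<phi> b - \<phi> a)" if "(a, b) \<in> ?D" for a b
  proof -
    have "\<phi> a \<noteq> \<phi> b"
      using that inj_on_eq_iff[OF assms(3)] by simp
    then have "\<exists>x. x \<in> (\<phi> a - \<phi> b) \<union> (\<phi> b - \<phi> a)"
      by blast
    from someI_ex[OF this] show ?thesis
      by (simp add: s_def)
  qed
  have "?D \<subseteq> A \<times> A"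
    by blast
  then have "?D \<lesssim> K"
    using Times_lepoll_infinite[OF assms(1,2,2)] by (blast intro: lepoll_trans subset_imp_lepoll)
  then have "s ` ?D \<lesssim> K"
    by (rule lepoll_trans[OF image_lepoll])
  moreover have "inj_on (\<lambda>a. \<phi> a \<inter> s ` ?D) A"
  proof (rule inj_onI, rule ccontr)
    fix a b assume "a \<in> A" "b \<in> A" and eq: "\<phi> a \<inter> s ` ?D = \<phi> b \<inter> s ` ?D" and "a \<noteq> b"
    then have ab: "(a, b) \<in> ?D"
      by blast
    then show False
      using s[OF ab] eq by blast
  qed
  moreover have "s ` ?D \<subseteq> (\<Union>a\<in>A. \<phi> a)"
  proof (rule image_subsetI)
    fix p assume "p \<in> ?D"
    moreover obtain a b where "p = (a, b)"
      by (cases p)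
    ultimately show "s p \<in> (\<Union>a\<in>A. \<phi> a)"
      using s[of a b] by auto
  qed
  ultimately show ?thesis
    by (intro that[of "s ` ?D"])
qed

lemma inj_on_Int_mono:
  assumes "inj_on (\<lambda>a. \<phi> a \<inter> C) A" "C \<subseteq> D"
  shows "inj_on (\<lambda>a. \<phi> a \<inter> D) A"
proof (rule inj_onI)
  fix a b assume ab: "a \<in> A" "b \<in> A" and "\<phi> a \<inter> D = \<phi> b \<inter> D"
  then have "\<phi> a \<inter> C = \<phi> b \<inter> C"
    using assms(2) by blast
  then show "a = b"
    using inj_onD[OF assms(1) _ ab] by simp
qed

text \<open>
  Meet, converse and top restrict to any subset of \<open>I\<close>; composition restricts to a subset that
  contains an intermediate point for each pair of its points that is related by a composite.
\<close>

lemma shrink_rel_embedding: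
  fixes I :: "'i set"
  assumes K: "infinite K" and A: "carrier A \<lesssim> K" and \<phi>: "embedding A (rel_alg I) \<phi>"
  obtains J :: "'i set" and \<psi> where "J \<lesssim> K" "embedding A (rel_alg J) \<psi>"
proof -
  note emb = \<phi>[unfolded embedding_rel_alg_iff]
  have sub: "\<phi> a \<subseteq> I \<times> I" if "a \<in> carrier A" for a
    using emb that by simp
  have inj: "inj_on \<phi> (carrier A)"
    using emb by simp
  obtain C where C: "C \<lesssim> K" "C \<subseteq> (\<Union>a\<in>carrier A. \<phi> a)" "inj_on (\<lambda>a. \<phi> a \<inter> C) (carrier A)"
    using small_separating_set[OF K A inj] .
  \<comment> \<open>Without an intermediate point, the value \<open>x\<close> keeps \<open>I\<close> closed under \<open>w\<close>.\<close>
  define w where "w = (\<lambda>(a, b) x z.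
    if (x, z) \<in> \<phi> a O \<phi> b then SOME y. (x, y) \<in> \<phi> a \<and> (y, z) \<in> \<phi> b else x)"
  have w: "(x, w (a, b) x z) \<in> \<phi> a \<and> (w (a, b) x z, z) \<in> \<phi> b" if "(x, z) \<in> \<phi> a O \<phi> b" for a b x z
  proof -
    have "\<exists>y. (x, y) \<in> \<phi> a \<and> (y, z) \<in> \<phi> b"
      using that by blast
    from someI_ex[OF this] show ?thesis
      using that by (simp add: w_def)
  qed
  have wI: "w p x z \<in> I" if pxz: "p \<in> carrier A \<times> carrier A" "x \<in> I" "z \<in> I" for p x z
  proof -
    obtain a b where p: "p = (a, b)" "a \<in> carrier A" "b \<in> carrier A"
      using pxz by blast
    show ?thesis
    proof (cases "(x, z) \<in> \<phi> a O \<phi> b")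
      case True
      then show ?thesis
        using w[OF True] sub[OF p(2)] p(1) by blast
    next
      case False
      then show ?thesis
        using p pxz by (simp add: w_def)
    qed
  qed
  obtain J where J: "fst ` C \<union> snd ` C \<subseteq> J" "J \<subseteq> I" "J \<lesssim> K"
    and wJ: "\<And>p x z. p \<in> carrier A \<times> carrier A \<Longrightarrow> x \<in> J \<Longrightarrow> z \<in> J \<Longrightarrow> w p x z \<in> J"
  proof (rule small_closed_set[of K "carrier A \<times> carrier A" "fst ` C \<union> snd ` C" I w])
    show "fst ` C \<union> snd ` C \<lesssim> K"
      by (intro Un_lepoll_infinite K lepoll_trans[OF image_lepoll C(1)])
    show "fst ` C \<union> snd ` C \<subseteq> I"
      using C(2) sub by fastforce
  qed (use K Times_lepoll_infinite[OF K A A] wI in blast)+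
  have "inj_on (\<lambda>a. \<phi> a \<inter> J \<times> J) (carrier A)"
    by (rule inj_on_Int_mono[OF C(3)]) (use J(1) in force)
  moreover have "(\<phi> a O \<phi> b) \<inter> J \<times> J = (\<phi> a \<inter> J \<times> J) O (\<phi> b \<inter> J \<times> J)"
    if "a \<in> carrier A" "b \<in> carrier A" for a b
  proof (intro equalityI subsetI)
    fix p assume p: "p \<in> (\<phi> a O \<phi> b) \<inter> J \<times> J"
    obtain x z where xz: "p = (x, z)"
      by (cases p)
    then have "w (a, b) x z \<in> J"
      using p that by (intro wJ) auto
    moreover have "(x, w (a, b) x z) \<in> \<phi> a" "(w (a, b) x z, z) \<in> \<phi> b"
      using w[of x z a b] p xz by auto
    ultimately show "p \<in> (\<phi> a \<inter> J \<times> J) O (\<phi> b \<inter> J \<times> J)"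
      using p xz by auto
  qed auto
  moreover have "Id_on J \<subseteq> \<phi> a \<inter> J \<times> J" if "a \<in> carrier A" for a
  proof -
    have "Id_on I \<subseteq> \<phi> a"
      using emb that by simp
    then show ?thesis
      using J(2) by auto
  qed
  moreover have "(I \<times> I) \<inter> (J \<times> J) = J \<times> J"
    using J(2) by blast
  moreover have "(\<phi> a \<inter> \<phi> b) \<inter> J \<times> J = (\<phi> a \<inter> J \<times> J) \<inter> (\<phi> b \<inter> J \<times> J)" for a b
    by blast
  ultimately have "embedding A (rel_alg J) (\<lambda>a. \<phi> a \<inter> J \<times> J)"
    using emb unfolding embedding_rel_alg_iff by (simp add: converse_Int converse_Times)
  then show ?thesis
    using J(3) that by blast
qed

lemma (in group) subgroup_div_closedI:
  assumes "H \<subseteq> carrier G" "\<one> \<in> H" "\<And>x y. x \<in> H \<Longrightarrow> y \<in> H \<Longrightarrow> x \<otimes> inv y \<in> H"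
  shows "subgroup H G"
proof -
  have inv: "inv x \<in> H" if "x \<in> H" for x
    using assms(3)[OF assms(2) that] assms(1) that by (simp add: subset_iff)
  have "x \<otimes> y \<in> H" if "x \<in> H" "y \<in> H" for x y
    using assms(3)[OF that(1) inv[OF that(2)]] assms(1) that by (simp add: subset_iff)
  then show ?thesis
    using assms inv by (auto intro: subgroupI)
qed

text \<open>
  To preserve products of sets, it suffices to close a subgroup under a choice of left factors,
  as the product and the left factor determine the right one.
\<close>

lemma shrink_subset_embedding:
  fixes G (structure)
  assumes K: "infinite K" and A: "carrier A \<lesssim> K" and "group G"
    and \<phi>: "embedding A (subset_alg G) \<phi>"
  obtains H \<psi> where "subgroup H G" "H \<lesssim> K" "embedding A (subset_alg (G\<lparr>carrier := H\<rparr>)) \<psi>"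
proof -
  interpret group G by fact
  note emb = \<phi>[unfolded embedding_subset_alg_iff]
  have sub_G: "\<phi> a \<subseteq> carrier G" if "a \<in> carrier A" for a
    using emb that by simp
  have inj: "inj_on \<phi> (carrier A)"
    using emb by simp
  obtain C where C: "C \<lesssim> K" "C \<subseteq> (\<Union>a\<in>carrier A. \<phi> a)" "inj_on (\<lambda>a. \<phi> a \<inter> C) (carrier A)"
    using small_separating_set[OF K A inj] .
  \<comment> \<open>The index \<open>None\<close> makes the closed set a subgroup; \<open>Some (a, b)\<close> chooses left
      factors of \<open>x\<close>, whatever \<open>y\<close> is, with \<open>x\<close> itself when there is none.\<close>
  define w where "w = (\<lambda>p x y. case p of None \<Rightarrow> x \<otimes> inv y
    | Some (a, b) \<Rightarrow> if x \<in> \<phi> a <#> \<phi> b then SOME g. g \<in> \<phi> a \<and> (\<exists>h\<in>\<phi> b. x = g \<otimes> h) else x)"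
  let ?B = "insert None (Some ` (carrier A \<times> carrier A))"
  have w: "w (Some (a, b)) x y \<in> \<phi> a \<and> (\<exists>h\<in>\<phi> b. x = w (Some (a, b)) x y \<otimes> h)"
    if "x \<in> \<phi> a <#> \<phi> b" for a b x y
  proof -
    have "\<exists>g. g \<in> \<phi> a \<and> (\<exists>h\<in>\<phi> b. x = g \<otimes> h)"
      using that by (auto simp: mem_set_mult)
    from someI_ex[OF this] show ?thesis
      using that by (simp add: w_def)
  qed
  have wG: "w p x y \<in> carrier G" if pxy: "p \<in> ?B" "x \<in> carrier G" "y \<in> carrier G" for p x y
  proof -
    consider "p = None" | a b where "p = Some (a, b)" "a \<in> carrier A" "b \<in> carrier A"
      using pxy by blast
    then show ?thesis
    proof cases
      case 1
      then show ?thesis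
        using pxy by (simp add: w_def)
    next
      case p: 2
      show ?thesis
      proof (cases "x \<in> \<phi> a <#> \<phi> b")
        case True
        then show ?thesis
          using w[OF True] sub_G[OF p(2)] p(1) by blast
      next
        case False
        then show ?thesis
          using p pxy by (simp add: w_def)
      qed
    qed
  qed
  have B: "?B \<lesssim> K"
  proof -
    have "{None} \<union> Some ` (carrier A \<times> carrier A) \<lesssim> K"
      by (intro Un_lepoll_infinite K lepoll_trans[OF image_lepoll Times_lepoll_infinite]
          A finite_lepoll_infinite) simp
    then show ?thesis
      by simp
  qed
  have C1: "insert \<one> C \<lesssim> K"
  proof -
    have "{\<one>} \<union> C \<lesssim> K"
      by (intro Un_lepoll_infinite K C(1) finite_lepoll_infinite) simp
    then show ?thesis
      by simp
  qed
  have C1_G: "insert \<one> C \<subseteq> carrier G"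
    using C(2) sub_G by fastforce
  obtain H where H: "insert \<one> C \<subseteq> H" "H \<subseteq> carrier G" "H \<lesssim> K"
    and wH: "\<And>p x y. p \<in> ?B \<Longrightarrow> x \<in> H \<Longrightarrow> y \<in> H \<Longrightarrow> w p x y \<in> H"
    by (rule small_closed_set[where f = w, OF K B C1 C1_G]) (erule (2) wG, erule (2) that)
  have sub: "subgroup H G"
  proof (rule subgroup_div_closedI)
    show "x \<otimes> inv y \<in> H" if "x \<in> H" "y \<in> H" for x y
      using wH[of None x y] that by (simp add: w_def)
  qed (use H in auto)
  let ?H = "G\<lparr>carrier := H\<rparr>"
  have "inj_on (\<lambda>a. \<phi> a \<inter> H) (carrier A)"
    by (rule inj_on_Int_mono[OF C(3)]) (use H(1) in auto)
  moreover have "(\<phi> a <#> \<phi> b) \<inter> H = (\<phi> a \<inter> H) <#>\<^bsub>?H\<^esub> (\<phi> b \<inter> H)"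
    if ab: "a \<in> carrier A" "b \<in> carrier A" for a b
  proof (intro equalityI subsetI)
    fix x assume x: "x \<in> (\<phi> a <#> \<phi> b) \<inter> H"
    define g where "g = w (Some (a, b)) x x"
    have gH: "g \<in> H"
      unfolding g_def using x ab by (intro wH) auto
    obtain h where g: "g \<in> \<phi> a" and h: "h \<in> \<phi> b" "x = g \<otimes> h"
      using w[OF IntD1[OF x], of x, folded g_def] by blast
    have "h \<in> carrier G"
      using h(1) sub_G[OF ab(2)] by blast
    moreover have "g \<in> carrier G"
      using gH H(2) by blast
    ultimately have "h = inv g \<otimes> x"
      unfolding h(2) by (simp flip: m_assoc)
    then have "h \<in> H"
      using subgroup.m_closed[OF sub subgroup.m_inv_closed[OF sub gH]] x by blast
    then show "x \<in> (\<phi> a \<inter> H) <#>\<^bsub>?H\<^esub> (\<phi> b \<inter> H)"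
      using g gH h unfolding mem_set_mult by auto
  next
    fix x assume "x \<in> (\<phi> a \<inter> H) <#>\<^bsub>?H\<^esub> (\<phi> b \<inter> H)"
    then show "x \<in> (\<phi> a <#> \<phi> b) \<inter> H"
      using subgroup.m_closed[OF sub] unfolding mem_set_mult Int_iff by auto
  qed
  moreover have "(set_inv (\<phi> a)) \<inter> H = set_inv\<^bsub>?H\<^esub> (\<phi> a \<inter> H)" if a: "a \<in> carrier A" for a
  proof (intro equalityI subsetI)
    fix x assume "x \<in> (set_inv (\<phi> a)) \<inter> H"
    then obtain g where g: "g \<in> \<phi> a" "x = inv g" "inv g \<in> H"
      by (auto simp: mem_set_inv)
    moreover have "g \<in> carrier G"
      using g(1) sub_G[OF a] by blast
    ultimately have "g \<in> H"
      using subgroup.m_inv_closed[OF sub g(3)] by simp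
    then show "x \<in> set_inv\<^bsub>?H\<^esub> (\<phi> a \<inter> H)"
      using g m_inv_consistent[OF sub] by (auto simp: mem_set_inv)
  next
    fix x assume "x \<in> set_inv\<^bsub>?H\<^esub> (\<phi> a \<inter> H)"
    then show "x \<in> (set_inv (\<phi> a)) \<inter> H"
      using m_inv_consistent[OF sub] subgroup.m_inv_closed[OF sub] by (auto simp: mem_set_inv)
  qed
  ultimately have "embedding A (subset_alg ?H) (\<lambda>a. \<phi> a \<inter> H)"
    using emb H Int_absorb1[OF H(2)] unfolding embedding_subset_alg_iff
    by (simp add: Int_left_commute Int_assoc)
  then show ?thesis
    using sub H(3) that by blast
qed

text \<open>
  The target type \<open>'w\<close> itself serves as the infinite set that bounds the size of the shrunken set
  or group, which therefore has a copy on \<open>'w\<close>.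
\<close>

lemma embeddable_rel_alg_change_type:
  fixes I :: "'i set" and A :: "'a alg"
  assumes "is_alg A" "embeddable A (rel_alg I)"
    and "infinite (UNIV :: 'w set)" "carrier A \<lesssim> (UNIV :: 'w set)"
  shows "\<exists>J :: 'w set. embeddable A (rel_alg J)"
proof -
  obtain \<phi> where \<phi>: "embedding A (rel_alg I) \<phi>"
    using assms(2) by (auto simp: embeddable_def)
  obtain J :: "'i set" and \<psi> where J: "J \<lesssim> (UNIV :: 'w set)" "embedding A (rel_alg J) \<psi>"
    by (rule shrink_rel_embedding[OF assms(3,4) \<phi>])
  then obtain u :: "'i \<Rightarrow> 'w" where "inj_on u J"
    by (auto simp: lepoll_def)
  then show ?thesis
    using embedding_compose[OF assms(1) J(2) embedding_rel_alg_image] by (auto simp: embeddable_def)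
qed

lemma embeddable_subset_alg_change_type:
  fixes G :: "'g monoid" and A :: "'a alg"
  assumes "is_alg A" "group G" "embeddable A (subset_alg G)"
    and "infinite (UNIV :: 'w set)" "carrier A \<lesssim> (UNIV :: 'w set)"
  shows "\<exists>H :: 'w monoid. group H \<and> embeddable A (subset_alg H)"
proof -
  obtain \<phi> where \<phi>: "embedding A (subset_alg G) \<phi>"
    using assms(3) by (auto simp: embeddable_def)
  obtain H \<psi> where H: "subgroup H G" "H \<lesssim> (UNIV :: 'w set)"
      "embedding A (subset_alg (G\<lparr>carrier := H\<rparr>)) \<psi>"
    by (rule shrink_subset_embedding[OF assms(4,5,2) \<phi>])
  obtain u :: "'g \<Rightarrow> 'w" where u: "inj_on u H"
    using H(2) by (auto simp: lepoll_def)
  let ?H = "G\<lparr>carrier := H\<rparr>"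
  have grp: "group ?H"
    using subgroup.subgroup_is_group[OF H(1) assms(2)] .
  have "u \<in> iso ?H (image_group u ?H)" "group (image_group u ?H)"
    using u group.inj_imp_image_group_is_group[OF grp] by (auto intro: inj_imp_image_group_iso)
  then show ?thesis
    using embedding_compose[OF assms(1) H(3) embedding_subset_alg_iso[OF grp]]
    by (auto simp: embeddable_def)
qed

section \<open>The correspondence between relation algebras and subset algebras\<close>

lemma embeddable_subset_alg_if_rel_alg:
  fixes I :: "'i set"
  assumes "is_alg A" "embeddable A (rel_alg I)"
  shows "\<exists>G :: ('i \<times> nat \<Rightarrow> 'i \<times> nat) monoid. group G \<and> embeddable A (subset_alg G)"
proof -
  interpret infinite_family I "\<lambda>i. {i} \<times> (UNIV :: nat set)"
    by (rule infinite_family_copies_of_nat)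
  show ?thesis
    using assms embedding_compose[OF _ _ embedding_fam_rel_set] group_fam_group
    unfolding embeddable_def by blast
qed

lemma embeddable_rel_alg_if_subset_alg:
  assumes "is_alg A" "group G" "embeddable A (subset_alg G)"
  shows "embeddable A (rel_alg (carrier G))"
  using assms embedding_compose[OF _ _ group.embedding_left_translates]
  unfolding embeddable_def by blast

lemma universe_large:
  fixes C :: "'a set"
  shows "infinite (UNIV :: ('a, 'u) universe set)" "C \<lesssim> (UNIV :: ('a, 'u) universe set)"
  by (auto simp: lepoll_def intro!: exI[of _ Inl] simp flip: UNIV_Plus_UNIV)

theorem theorem4:
  shows
    "(\<forall>I :: 'i set.
        (\<exists>G :: ('i \<times> nat \<Rightarrow> 'i \<times> nat) monoid.
            group G \<and> (\<exists>f. embedding (rel_alg I) (subset_alg G) f)) \<and>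
        (\<forall>X :: 'i \<Rightarrow> 'x set.
            disjoint_family_on X I \<and> (\<forall>i\<in>I. infinite (X i)) \<longrightarrow>
            group (fam_group I X) \<and>
            embedding (rel_alg I) (subset_alg (fam_group I X)) (fam_rel_set I X)))
     \<and>
     (\<forall>G :: 'g monoid. group G \<longrightarrow>
        (\<exists>(I :: 'g set) f. embedding (subset_alg G) (rel_alg I) f) \<and>
        embedding (subset_alg G) (rel_alg (carrier G))
          (\<lambda>S. {(g, g \<otimes>\<^bsub>G\<^esub> s) | g s. g \<in> carrier G \<and> s \<in> S}) \<and>
        (\<forall>S \<in> carrier (subset_alg G).
           {(g, g \<otimes>\<^bsub>G\<^esub> s) | g s. g \<in> carrier G \<and> s \<in> S} =
           {(g, h) \<in> carrier G \<times> carrier G. inv\<^bsub>G\<^esub> g \<otimes>\<^bsub>G\<^esub> h \<in> S}))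
     \<and>
     (\<forall>A :: 'a alg. is_alg A \<longrightarrow>
        ((\<exists>I :: ('a, 'u) universe set. embeddable A (rel_alg I)) \<longleftrightarrow>
         (\<exists>G :: ('a, 'v) universe monoid. group G \<and> embeddable A (subset_alg G))))"
proof (intro conjI allI impI)
  fix I :: "'i set"
  interpret infinite_family I "\<lambda>i. {i} \<times> (UNIV :: nat set)"
    by (rule infinite_family_copies_of_nat)
  show "\<exists>G :: ('i \<times> nat \<Rightarrow> 'i \<times> nat) monoid.
      group G \<and> (\<exists>f. embedding (rel_alg I) (subset_alg G) f)"
    using group_fam_group embedding_fam_rel_set by blast
next
  fix I :: "'i set" and X :: "'i \<Rightarrow> 'x set"
  assume "disjoint_family_on X I \<and> (\<forall>i\<in>I. infinite (X i))"
  then interpret infinite_family I X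
    by unfold_locales auto
  show "group (fam_group I X)"
    by (rule group_fam_group)
  show "embedding (rel_alg I) (subset_alg (fam_group I X)) (fam_rel_set I X)"
    by (rule embedding_fam_rel_set)
next
  fix G :: "'g monoid" assume "group G"
  then interpret group G .
  show emb: "embedding (subset_alg G) (rel_alg (carrier G))
      (\<lambda>S. {(g, g \<otimes>\<^bsub>G\<^esub> s) | g s. g \<in> carrier G \<and> s \<in> S})"
    by (rule embedding_left_translates)
  show "\<exists>(I :: 'g set) f. embedding (subset_alg G) (rel_alg I) f"
    using emb by blast
  show "\<forall>S \<in> carrier (subset_alg G).
      {(g, g \<otimes>\<^bsub>G\<^esub> s) | g s. g \<in> carrier G \<and> s \<in> S} =
      {(g, h) \<in> carrier G \<times> carrier G. inv\<^bsub>G\<^esub> g \<otimes>\<^bsub>G\<^esub> h \<in> S}"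
    by (intro ballI left_translates_eq) (simp add: subset_alg_def)
next
  fix A :: "'a alg" assume A: "is_alg A"
  show "(\<exists>I :: ('a, 'u) universe set. embeddable A (rel_alg I)) \<longleftrightarrow>
    (\<exists>G :: ('a, 'v) universe monoid. group G \<and> embeddable A (subset_alg G))"
  proof
    assume "\<exists>I :: ('a, 'u) universe set. embeddable A (rel_alg I)"
    then show "\<exists>G :: ('a, 'v) universe monoid. group G \<and> embeddable A (subset_alg G)"
      using embeddable_subset_alg_if_rel_alg[OF A]
        embeddable_subset_alg_change_type[OF A] universe_large by metis
  next
    assume "\<exists>G :: ('a, 'v) universe monoid. group G \<and> embeddable A (subset_alg G)"
    then show "\<exists>I :: ('a, 'u) universe set. embeddable A (rel_alg I)"
      using embeddable_rel_alg_if_subset_alg[OF A]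
        embeddable_rel_alg_change_type[OF A] universe_large by metis
  qed
qed

end
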